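(* Let $\Gamma\le E(n)$ be a discrete group of isometries of $\mathbb{R}^n$, and let $A\colon\mathbb{R}^n\to\mathbb{R}^n$ be a linear conformal map. Suppose that $A$ is expanding and $A\Gamma A^{-1}\subset\Gamma$. Then $\dim\Gamma_T=\dim\Gamma$, where $\Gamma_T$ is the translation subgroup of $\Gamma$.
   Context: $E(n)$ denotes the group of isometries of $\mathbb{R}^n$; each $\gamma\in E(n)$ has the form $x\mapsto Bx+b$ with $B\in O(n)$, $b\in\mathbb{R}^n$, and we write $\operatorname{ort}(\gamma)=B$, $T(\gamma)=b$. $E(n)$ carries the topology of $O(n)\times\mathbb{R}^n$; discreteness refers to this topology. The translation subgroup is $\Gamma_T=\{\gamma\in\Gamma:\operatorname{ort}(\gamma)=\mathrm{id}\}$. For a discrete $\Gamma\le E(n)$, a subgroup $G\le\Gamma$ and an affine subspace $V$, $(G,V)$ is a cocompact translation pair of $\Gamma$ if $gV=V$ and $g|_V$ is a translation of $V$ for all $g\in G$, and $V/G$ is compact; it is a finite index cocompact translation pair if moreover $[\Gamma:G]<\infty$. Such pairs always exist, and $\dim\Gamma:=\dim V$ for any such pair (independent of the choice); $\dim\Gamma_T$ is defined likewise. A linear conformal map is $A=\lambda A'$ with $\lambda>0$ and $A'\in SO(n)$; it is expanding if $\lambda>1$. $A\Gamma A^{-1}=\{A\gamma A^{-1}:\gamma\in\Gamma\}$, viewed as maps of $\mathbb{R}^n$. *)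

theory Defs
  imports "HOL-Analysis.Analysis"
begin

type_synonym 'n isom = "real^'n \<Rightarrow> real^'n"

definition isometry_E :: "'n::finite isom \<Rightarrow> bool" where
  "isometry_E \<gamma> \<longleftrightarrow> (\<exists>B b. orthogonal_transformation B \<and> \<gamma> = (\<lambda>x. B x + b))"

definition ort :: "'n::finite isom \<Rightarrow> real^'n^'n" where
  "ort \<gamma> = matrix (\<lambda>x. \<gamma> x - \<gamma> 0)"

definition transl_part :: "'n::finite isom \<Rightarrow> real^'n" where
  "transl_part \<gamma> = \<gamma> 0"

definition isom_group :: "'n::finite isom set \<Rightarrow> bool" where
  "isom_group \<Gamma> \<longleftrightarrow> (\<forall>\<gamma>\<in>\<Gamma>. isometry_E \<gamma>) \<and> id \<in> \<Gamma> \<and>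
     (\<forall>\<gamma>\<in>\<Gamma>. \<forall>\<delta>\<in>\<Gamma>. \<gamma> \<circ> \<delta> \<in> \<Gamma>) \<and> (\<forall>\<gamma>\<in>\<Gamma>. inv \<gamma> \<in> \<Gamma>)"

definition discrete_isom_group :: "'n::finite isom set \<Rightarrow> bool" where
  "discrete_isom_group \<Gamma> \<longleftrightarrow> isom_group \<Gamma> \<and>
     (\<forall>\<gamma>\<in>\<Gamma>. \<exists>e>0. \<forall>\<delta>\<in>\<Gamma>.
        dist (ort \<delta>, transl_part \<delta>) (ort \<gamma>, transl_part \<gamma>) < e \<longrightarrow> \<delta> = \<gamma>)"

definition subgroup_of :: "'n::finite isom set \<Rightarrow> 'n isom set \<Rightarrow> bool" where
  "subgroup_of G \<Gamma> \<longleftrightarrow> G \<subseteq> \<Gamma> \<and> id \<in> G \<and>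
     (\<forall>g\<in>G. \<forall>h\<in>G. g \<circ> h \<in> G) \<and> (\<forall>g\<in>G. inv g \<in> G)"

definition finite_index :: "'n::finite isom set \<Rightarrow> 'n isom set \<Rightarrow> bool" where
  "finite_index G \<Gamma> \<longleftrightarrow> finite ((\<lambda>\<gamma>. (\<lambda>g. \<gamma> \<circ> g) ` G) ` \<Gamma>)"

definition transl_subgroup :: "'n::finite isom set \<Rightarrow> 'n isom set" where
  "transl_subgroup \<Gamma> = {\<gamma>\<in>\<Gamma>. ort \<gamma> = mat 1}"

text \<open>(G,V) cocompact translation pair: V a (nonempty) affine subspace, each g\<in>G
  maps V onto V acting as a translation on V, and V/G compact (i.e. V is covered
  by the G-translates of a compact subset of V).\<close>
definition cocompact_translation_pair ::
  "'n::finite isom set \<Rightarrow> 'n isom set \<Rightarrow> (real^'n) set \<Rightarrow> bool" where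
  "cocompact_translation_pair \<Gamma> G V \<longleftrightarrow> subgroup_of G \<Gamma> \<and> affine V \<and> V \<noteq> {} \<and>
     (\<forall>g\<in>G. g ` V = V \<and> (\<exists>v. \<forall>x\<in>V. g x = x + v)) \<and>
     (\<exists>K. compact K \<and> K \<subseteq> V \<and> V = (\<Union>g\<in>G. g ` K))"

definition fi_cocompact_translation_pair ::
  "'n::finite isom set \<Rightarrow> 'n isom set \<Rightarrow> (real^'n) set \<Rightarrow> bool" where
  "fi_cocompact_translation_pair \<Gamma> G V \<longleftrightarrow>
     cocompact_translation_pair \<Gamma> G V \<and> finite_index G \<Gamma>"

definition dim_group :: "'n::finite isom set \<Rightarrow> int" where
  "dim_group \<Gamma> = (SOME d. \<exists>G V. fi_cocompact_translation_pair \<Gamma> G V \<and> aff_dim V = d)"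

definition expanding_conformal :: "'n::finite isom \<Rightarrow> bool" where
  "expanding_conformal A \<longleftrightarrow> (\<exists>c A'. c > 1 \<and> orthogonal_transformation A' \<and>
      det (matrix A') = 1 \<and> A = (\<lambda>x. c *\<^sub>R A' x))"

end

theory Submission
  imports Defs
begin

text \<open>
  The point group \<open>ort \<Gamma>\<close> is finite, so \<open>\<Gamma>\<^sub>T\<close> has finite index in \<open>\<Gamma>\<close>, and \<open>\<Gamma>\<^sub>T\<close> with the span
  of its translation vectors is a pair for both groups. To see this, write \<open>A = c Q\<close> and choose \<open>k > 0\<close>
  such that \<open>X = Q\<^sup>k\<close> is near the identity. Let \<open>\<gamma> = (B, b) \<in> \<Gamma>\<close> with \<open>B\<close> near the identity. Its
  conjugate by \<open>A\<^sup>k\<close> is \<open>\<delta> = (X B X\<^sup>-\<^sup>1, c\<^sup>k X b) \<in> \<Gamma>\<close>. The iterated commutators of \<open>\<gamma>\<close> with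
  \<open>\<gamma> \<delta>\<^sup>-\<^sup>1\<close>, whose linear part is \<open>[B, X]\<close>, contract to the identity, hence reach it by
  discreteness; by a lemma of Frobenius, \<open>B\<close> and \<open>X\<close> then commute. So \<open>\<delta> \<gamma>\<^sup>-\<^sup>1\<close> is the
  translation by \<open>(c\<^sup>k X - 1) b\<close>. Since \<open>c\<^sup>k X - 1\<close> is invertible and preserves the span of the
  translation vectors, \<open>b\<close> lies in that span, and modulo \<open>\<Gamma>\<^sub>T\<close> it may be taken bounded. Hence only
  finitely many such \<open>B\<close> occur, and compactness of the orthogonal group gives the claim.
\<close>

section \<open>Linear parts of isometries\<close>

text \<open>\<open>ort\<close> is the matrix of this map. Keeping the linear part as a function
  gives direct access to composition, inverses and iterates.\<close>

definition lin :: "'n::finite isom \<Rightarrow> 'n isom" where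
  "lin \<gamma> = (\<lambda>x. \<gamma> x - \<gamma> 0)"

text \<open>For linear \<open>f\<close> this says that \<open>f - id\<close> has operator norm at
  most \<open>e\<close>.\<close>

definition near :: "real \<Rightarrow> 'n::finite isom \<Rightarrow> bool" where
  "near e f \<longleftrightarrow> (\<forall>v. norm (f v - v) \<le> e * norm v)"

definition commut :: "'n::finite isom \<Rightarrow> 'n isom \<Rightarrow> 'n isom" where
  "commut \<gamma> \<delta> = \<gamma> \<circ> \<delta> \<circ> inv \<gamma> \<circ> inv \<delta>"

lemma lin_apply: "\<gamma> x = lin \<gamma> x + \<gamma> 0"
  by (simp add: lin_def)

lemma lin_affine:
  assumes "linear B" shows "lin (\<lambda>x. B x + b) = B"
  using linear_0[OF assms] by (simp add: lin_def fun_eq_iff)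

lemma orthogonal_lin:
  assumes "isometry_E \<gamma>" shows "orthogonal_transformation (lin \<gamma>)"
  using assms lin_affine unfolding isometry_E_def orthogonal_transformation_def by metis

lemma isometry_E_dist:
  assumes "isometry_E \<gamma>" shows "norm (\<gamma> x - \<gamma> y) = norm (x - y)"
proof -
  have "\<gamma> x - \<gamma> y = lin \<gamma> (x - y)"
    using orthogonal_lin[OF assms] lin_apply[of \<gamma> x] lin_apply[of \<gamma> y]
    by (simp add: orthogonal_transformation_linear linear_diff)
  then show ?thesis using orthogonal_lin[OF assms] by (simp add: orthogonal_transformation_norm)
qed

lemma bij_isometry_E:
  assumes "isometry_E \<gamma>" shows "bij \<gamma>"
proof (rule bijI)
  show "inj \<gamma>" using isometry_E_dist[OF assms] by (metis injI norm_eq_zero right_minus_eq)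
  have "surj (lin \<gamma>)" using orthogonal_lin[OF assms] orthogonal_transformation_surj by blast
  show "surj \<gamma>"
  proof (rule surjI)
    fix y show "\<gamma> (inv (lin \<gamma>) (y - \<gamma> 0)) = y"
      using surj_f_inv_f[OF \<open>surj (lin \<gamma>)\<close>, of "y - \<gamma> 0"]
        lin_apply[of \<gamma> "inv (lin \<gamma>) (y - \<gamma> 0)"] by simp
  qed
qed

lemma isometry_E_inv_cancel:
  assumes "isometry_E \<gamma>" shows "\<gamma> (inv \<gamma> x) = x" "inv \<gamma> (\<gamma> x) = x"
  using bij_isometry_E[OF assms] by (simp_all add: bij_is_surj surj_f_inv_f bij_is_inj)

lemma orthogonal_inv_cancel:
  fixes B :: "'n::finite isom"
  assumes "orthogonal_transformation B" shows "B (inv B x) = x" "inv B (B x) = x"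
  using orthogonal_transformation_bij[OF assms] by (simp_all add: bij_is_surj surj_f_inv_f bij_is_inj)

lemma lin_compose:
  assumes "isometry_E \<gamma>" shows "lin (\<gamma> \<circ> \<delta>) = lin \<gamma> \<circ> lin \<delta>"
proof
  fix x show "lin (\<gamma> \<circ> \<delta>) x = (lin \<gamma> \<circ> lin \<delta>) x"
    using orthogonal_lin[OF assms] lin_apply[of \<gamma> "\<delta> x"] lin_apply[of \<gamma> "\<delta> 0"]
    by (simp add: lin_def[of "\<gamma> \<circ> \<delta>"] lin_def[of \<delta>] orthogonal_transformation_linear linear_diff)
qed

lemma lin_inv:
  assumes "isometry_E \<gamma>" shows "lin (inv \<gamma>) = inv (lin \<gamma>)"
proof -
  have "lin \<gamma> \<circ> lin (inv \<gamma>) = lin id"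
    using lin_compose[OF assms, of "inv \<gamma>"] isometry_E_inv_cancel[OF assms]
    by (metis comp_apply eq_id_iff)
  then have "lin \<gamma> \<circ> lin (inv \<gamma>) = id" by (simp add: lin_def fun_eq_iff)
  then have "lin \<gamma> (lin (inv \<gamma>) x) = x" for x by (simp add: fun_eq_iff)
  then show ?thesis
    using orthogonal_inv_cancel(2)[OF orthogonal_lin[OF assms], of "lin (inv \<gamma>) x" for x] by auto
qed

lemma orthogonal_commut:
  assumes "orthogonal_transformation B" "orthogonal_transformation C"
  shows "orthogonal_transformation (commut B C)"
  unfolding commut_def
  by (intro orthogonal_transformation_compose orthogonal_transformation_inv assms)

lemma orthogonal_funpow:
  fixes B :: "'n::finite isom"
  assumes "orthogonal_transformation B"
  shows "orthogonal_transformation (B ^^ k)"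
proof (induction k)
  case 0
  have "B ^^ 0 = (\<lambda>x. x)" by auto
  then show ?case by (simp add: orthogonal_transformation_def linear_id[unfolded id_def] id_def)
next
  case (Suc k) then show ?case unfolding funpow.simps by (rule orthogonal_transformation_compose[OF assms])
qed

lemma orthogonal_matrix_mult:
  fixes B :: "'n::finite isom"
  assumes "orthogonal_transformation B" shows "matrix B *v x = B x"
  using matrix_works[of B] orthogonal_transformation_linear[OF assms]
  by (simp add: linear_def scalar_mult_eq_scaleR[abs_def])

lemma ort_eq_iff:
  assumes "isometry_E \<gamma>" "isometry_E \<delta>"
  shows "ort \<gamma> = ort \<delta> \<longleftrightarrow> lin \<gamma> = lin \<delta>"
  using orthogonal_matrix_mult[OF orthogonal_lin[OF assms(1)]]
    orthogonal_matrix_mult[OF orthogonal_lin[OF assms(2)]]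
  unfolding ort_def lin_def[symmetric] by auto

lemma ort_mult:
  assumes "isometry_E \<gamma>" shows "ort \<gamma> *v x = lin \<gamma> x"
  using orthogonal_matrix_mult[OF orthogonal_lin[OF assms]]
  unfolding ort_def lin_def[symmetric] .

section \<open>Matrix norms and accumulation points\<close>

text \<open>The norm on matrices is the Frobenius norm. Each entry is bounded by the norm of its
  column, and summing over all entries gives a crude bound, applied below to orthogonal matrices and
  to differences from the identity.\<close>

lemma norm_matrix_le_columns:
  fixes M :: "real^'n^'m"
  assumes "\<And>j. norm (M *v axis j 1) \<le> e"
  shows "norm M \<le> real CARD('m) * real CARD('n) * e"
proof -
  have entry: "\<bar>M $ i $ j\<bar> \<le> e" for i j
  proof -
    have "M $ i $ j = (M *v axis j 1) $ i"
      by (simp add: matrix_vector_mult_basis column_def)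
    then show ?thesis using assms[of j] component_le_norm_cart[of "M *v axis j 1" i] by simp
  qed
  have "norm M \<le> (\<Sum>i\<in>UNIV. norm (M $ i))"
    unfolding norm_vec_def[of M] by (intro L2_set_le_sum) auto
  also have "\<dots> \<le> (\<Sum>i\<in>(UNIV::'m set). \<Sum>j\<in>(UNIV::'n set). e)"
    by (intro sum_mono order_trans[OF norm_le_l1_cart] entry)
  finally show ?thesis by (simp add: algebra_simps)
qed

text \<open>By Cauchy-Schwarz in each row, the Frobenius norm dominates the operator norm.\<close>

lemma norm_matrix_mult_le:
  fixes M :: "real^'n^'m"
  shows "norm (M *v x) \<le> norm M * norm x"
proof -
  have "norm (M *v x) = L2_set (\<lambda>i. (M *v x) $ i) UNIV" by (simp add: norm_vec_def L2_set_def)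
  also have "\<dots> = L2_set (\<lambda>i. \<bar>(M *v x) $ i\<bar>) UNIV" by (simp add: L2_set_def)
  also have "\<dots> \<le> L2_set (\<lambda>i. norm (M $ i) * norm x) UNIV"
    by (intro L2_set_mono) (simp_all add: matrix_vector_mul_component Cauchy_Schwarz_ineq2)
  also have "\<dots> = norm M * norm x"
    by (simp add: norm_vec_def[of M] L2_set_left_distrib)
  finally show ?thesis .
qed

lemma norm_orthogonal_matrix_le:
  assumes "orthogonal_transformation B"
  shows "norm (matrix B :: real^'n^'n) \<le> real CARD('n) * real CARD('n)"
proof -
  have "norm (matrix B *v axis j 1) \<le> 1" for j
    using assms by (simp add: orthogonal_matrix_mult orthogonal_transformation_norm)
  from norm_matrix_le_columns[OF this] show ?thesis by simp
qed

text \<open>Applying the isometry \<open>B\<close> to the displacement of \<open>v\<close> gives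
  \<open>C v - B v\<close>. Closeness of two linear parts thus becomes closeness of their quotient
  to the identity.\<close>

lemma near_inv_compose:
  fixes B C :: "'n::finite isom"
  assumes "orthogonal_transformation B" "orthogonal_transformation C"
    "norm (matrix C - matrix B) \<le> e"
  shows "near e (inv B \<circ> C)"
  unfolding near_def
proof
  fix v
  have "norm ((inv B \<circ> C) v - v) = norm (B (inv B (C v) - v))"
    using assms(1) by (simp add: orthogonal_transformation_norm)
  also have "\<dots> = norm (C v - B v)"
    using assms(1) by (simp add: orthogonal_transformation_linear linear_diff orthogonal_inv_cancel)
  also have "\<dots> = norm ((matrix C - matrix B) *v v)"
    using assms by (simp add: matrix_vector_mult_diff_rdistrib orthogonal_matrix_mult)
  also have "\<dots> \<le> norm (matrix C - matrix B) * norm v" by (rule norm_matrix_mult_le)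
  also have "\<dots> \<le> e * norm v" using assms(3) by (intro mult_right_mono) auto
  finally show "norm ((inv B \<circ> C) v - v) \<le> e * norm v" .
qed

text \<open>A point of \<open>S\<close> within \<open>e/2\<close> of a limit point serves as centre.
  A centre inside \<open>S\<close> can be divided out when \<open>S\<close> comes from a
  group.\<close>

lemma infinite_bounded_cluster:
  fixes S :: "'a::euclidean_space set"
  assumes "infinite S" "bounded S" "e > 0"
  shows "\<exists>x\<in>S. infinite (S \<inter> ball x e)"
proof -
  obtain l where "l islimpt S"
    using assms(1,2) bounded_infinite_imp_islimpt[of S S] by blast
  then have inf: "infinite (S \<inter> ball l (e/2))"
    using assms(3) by (simp add: islimpt_eq_infinite_ball)
  then have "S \<inter> ball l (e/2) \<noteq> {}" by force
  then obtain x where x: "x \<in> S" "dist l x < e/2" by auto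
  have "S \<inter> ball l (e/2) \<subseteq> S \<inter> ball x e"
  proof
    fix y assume "y \<in> S \<inter> ball l (e/2)"
    then show "y \<in> S \<inter> ball x e" using x dist_triangle[of x y l] by (auto simp: dist_commute)
  qed
  then show ?thesis using inf x finite_subset by blast
qed

section \<open>Commutators\<close>

text \<open>No small subgroups: as long as \<open>Q\<close> stays within \<open>1/2\<close> of the identity, squaring it
  multiplies its displacement by at least \<open>3/2\<close>.\<close>
lemma powers_near_imp_id:
  fixes Z :: "'n::finite isom"
  assumes "linear Z" "\<And>m. near (1/2) (Z ^^ m)"
  shows "Z = id"
proof
  fix v
  have step: "norm (Q (Q v) - v) \<ge> 3/2 * norm (Q v - v)" if "linear Q" "near (1/2) Q" for Q :: "'n isom"
  proof -
    let ?u = "Q v - v"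
    \<comment> \<open>Since \<open>Q v = v + ?u\<close>, linearity gives
      \<open>Q (Q v) - v = ?u + Q ?u\<close>; in this form the doubled displacement dominates the
      error term.\<close>
    have "Q (Q v) - v = 2 *\<^sub>R ?u + (Q ?u - ?u)"
      using that(1) by (simp add: linear_diff scaleR_2)
    moreover have "norm (Q ?u - ?u) \<le> 1/2 * norm ?u" using that(2) unfolding near_def by blast
    moreover have "norm (2 *\<^sub>R ?u) = 2 * norm ?u" by simp
    moreover have "norm (2 *\<^sub>R ?u) - norm (Q ?u - ?u) \<le> norm (2 *\<^sub>R ?u + (Q ?u - ?u))"
      by (rule norm_diff_ineq)
    ultimately have "norm (2 *\<^sub>R ?u + (Q ?u - ?u)) \<ge> 3/2 * norm ?u" by linarith
    then show ?thesis using \<open>Q (Q v) - v = _\<close> by metis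
  qed
  have lin: "linear (Z ^^ m)" for m
  proof (induction m)
    case 0 show ?case using linear_id by (simp add: id_def)
  next
    case (Suc m) then show ?case using assms(1) linear_compose by (simp del: o_apply)
  qed
  have "(3/2)^k * norm (Z v - v) \<le> norm ((Z ^^ (2^k)) v - v)" for k
  proof (induction k)
    case (Suc k)
    have "(Z ^^ (2^Suc k)) v = (Z ^^ (2^k)) ((Z ^^ (2^k)) v)"
      by (simp add: funpow_add mult_2)
    then show ?case using step[OF lin assms(2), of "2^k"] Suc.IH by simp
  qed simp
  moreover have "norm ((Z ^^ m) v - v) \<le> 1/2 * norm v" for m
    using assms(2)[of m] unfolding near_def by blast
  ultimately have bd: "(3/2)^k * norm (Z v - v) \<le> 1/2 * norm v" for k :: nat
    by (meson order_trans)
  have "norm (Z v - v) = 0"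
  proof (rule ccontr)
    assume "norm (Z v - v) \<noteq> 0"
    then have pos: "norm (Z v - v) > 0" by simp
    obtain k where "(3/2::real)^k > 1/2 * norm v / norm (Z v - v)"
      using real_arch_pow[of "3/2::real"] by auto
    then show False using bd[of k] pos by (simp add: field_simps)
  qed
  then show "Z v = id v" by simp
qed

text \<open>If \<open>B\<close> commutes with \<open>Z = [B, Y]\<close>, then \<open>B\<^sup>m Y B\<^sup>-\<^sup>m = Z\<^sup>m Y\<close>, so the powers of \<open>Z\<close> all
  stay near the identity.\<close>
lemma commut_eq_id_descend:
  fixes B Y :: "'n::finite isom"
  assumes B: "orthogonal_transformation B" and Y: "orthogonal_transformation Y"
    and Y4: "near (1/4) Y" and BB: "commut B (commut B Y) = id"
  shows "commut B Y = id"
proof -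
  define Z where "Z = commut B Y"
  have Z: "orthogonal_transformation Z" unfolding Z_def by (rule orthogonal_commut[OF B Y])
  have BY: "B (Y x) = Z (Y (B x))" for x
    by (simp add: Z_def commut_def orthogonal_inv_cancel B Y)
  have BZ: "B (Z x) = Z (B x)" for x
  proof -
    have "B (Z (inv B (inv Z (Z (B x))))) = Z (B x)"
      using fun_cong[OF BB[folded Z_def], of "Z (B x)"] by (simp add: commut_def)
    then show ?thesis by (simp add: orthogonal_inv_cancel B Z)
  qed
  have BZm: "B ((Z ^^ m) x) = (Z ^^ m) (B x)" for m x
    by (induction m) (simp_all add: BZ)
  have Bm: "(B ^^ m) (Y x) = (Z ^^ m) (Y ((B ^^ m) x))" for m x
    by (induction m) (simp_all add: BZm BY funpow_swap1[of Z])
  have "near (1/2) (Z ^^ m)" for m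
    unfolding near_def
  proof
    fix u
    define P where "P = B ^^ m"
    have P: "orthogonal_transformation P" unfolding P_def by (rule orthogonal_funpow[OF B])
    \<comment> \<open>With this \<open>w\<close>, \<open>Bm\<close> turns \<open>(Z ^^ m) u\<close>
      into \<open>P (Y w)\<close>, while \<open>u = Y (P w)\<close>. The displacement of
      \<open>u\<close> is then a difference of two displacements by \<open>Y\<close>, each of size
      at most a quarter of the norm of \<open>u\<close>.\<close>
    define w where "w = inv P (inv Y u)"
    have u: "u = Y (P w)" by (simp add: w_def orthogonal_inv_cancel P Y)
    have nu: "norm u = norm w" using P Y by (simp add: u orthogonal_transformation_norm)
    have "(Z ^^ m) u - u = P (Y w - w) - (Y (P w) - P w)"
      using Bm[of m w] P by (simp add: u P_def[symmetric] orthogonal_transformation_linear linear_diff)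
    then have "norm ((Z ^^ m) u - u) \<le> norm (P (Y w - w)) + norm (Y (P w) - P w)"
      by (simp add: norm_triangle_ineq4)
    also have "\<dots> \<le> 1/4 * norm w + 1/4 * norm (P w)"
      using Y4 unfolding near_def orthogonal_transformation_norm[OF P]
      by (metis (no_types, lifting) P add_mono orthogonal_transformation_norm)
    also have "\<dots> = 1/2 * norm u" using P by (simp add: nu orthogonal_transformation_norm)
    finally show "norm ((Z ^^ m) u - u) \<le> 1/2 * norm u" .
  qed
  then have "Z = id" by (rule powers_near_imp_id[OF orthogonal_transformation_linear[OF Z]])
  then show ?thesis by (simp add: Z_def)
qed

text \<open>The identity \<open>BC - CB = (B - 1)(C - 1) - (C - 1)(B - 1)\<close> makes the bound a
  product of both displacements. This gain is what makes iterated commutators contract.\<close>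

lemma norm_commutator_diff_le:
  fixes B C :: "'n::finite isom"
  assumes "linear B" "linear C" "near \<beta> B" "near \<eta> C" "0 \<le> \<beta>" "0 \<le> \<eta>"
  shows "norm (B (C u) - C (B u)) \<le> 2 * \<beta> * \<eta> * norm u"
proof -
  have "B (C u) - C (B u) = (B (C u - u) - (C u - u)) - (C (B u - u) - (B u - u))"
    using assms(1,2) by (simp add: linear_diff)
  then have "norm (B (C u) - C (B u)) \<le> norm (B (C u - u) - (C u - u)) + norm (C (B u - u) - (B u - u))"
    by (metis norm_triangle_ineq4)
  also have "\<dots> \<le> \<beta> * norm (C u - u) + \<eta> * norm (B u - u)"
    using assms(3,4) unfolding near_def by (intro add_mono) auto
  also have "\<dots> \<le> \<beta> * (\<eta> * norm u) + \<eta> * (\<beta> * norm u)"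
    using assms(3-6) unfolding near_def by (intro add_mono mult_left_mono) auto
  finally show ?thesis by (simp add: algebra_simps)
qed

text \<open>Writing \<open>v = C (B u)\<close> turns \<open>commut B C v - v\<close> into
  \<open>B (C u) - C (B u)\<close>, with \<open>u\<close> and \<open>v\<close> of equal
  norm.\<close>

lemma near_commut:
  fixes B C :: "'n::finite isom"
  assumes B: "orthogonal_transformation B" and C: "orthogonal_transformation C"
    and "near \<beta> B" "near \<eta> C" "0 \<le> \<beta>" "0 \<le> \<eta>"
  shows "near (2 * \<beta> * \<eta>) (commut B C)"
  unfolding near_def
proof
  fix v
  define u where "u = inv B (inv C v)"
  have v: "v = C (B u)" by (simp add: u_def orthogonal_inv_cancel B C)
  have "norm u = norm v" using B C by (simp add: v orthogonal_transformation_norm)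
  moreover have "commut B C v = B (C u)" by (simp add: commut_def u_def)
  ultimately show "norm (commut B C v - v) \<le> 2 * \<beta> * \<eta> * norm v"
    using norm_commutator_diff_le[of B C \<beta> \<eta> u] assms
    by (simp add: v orthogonal_transformation_linear)
qed

text \<open>Let \<open>B\<close>, \<open>C\<close> be the linear parts and \<open>u\<close> the
  point with \<open>\<delta> (\<gamma> u) = 0\<close>. Then the commutator sends 0 to
  \<open>\<gamma> (\<delta> u) - \<delta> (\<gamma> u)\<close>, which is
  \<open>(BC - CB) u + (B - 1) (\<delta> 0) - (C - 1) (\<gamma> 0)\<close>, and every term carries a
  small factor.\<close>

lemma norm_commut_0_le:
  fixes \<gamma> \<delta> :: "'n::finite isom"
  assumes g: "isometry_E \<gamma>" and d: "isometry_E \<delta>"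
    and nB: "near \<beta> (lin \<gamma>)" and nC: "near \<eta> (lin \<delta>)" and pos: "0 \<le> \<beta>" "0 \<le> \<eta>"
  shows "norm (commut \<gamma> \<delta> 0) \<le>
    2 * \<beta> * \<eta> * (norm (\<gamma> 0) + norm (\<delta> 0)) + \<beta> * norm (\<delta> 0) + \<eta> * norm (\<gamma> 0)"
proof -
  define B C where "B = lin \<gamma>" and "C = lin \<delta>"
  have B: "orthogonal_transformation B" and C: "orthogonal_transformation C"
    unfolding B_def C_def using g d by (simp_all add: orthogonal_lin)
  define u where "u = inv \<gamma> (inv \<delta> 0)"
  have zero: "\<delta> (\<gamma> u) = 0" by (simp add: u_def isometry_E_inv_cancel g d)
  have "norm u = norm (\<delta> (\<gamma> u) - \<delta> (\<gamma> 0))"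
    by (simp add: isometry_E_dist[OF d] isometry_E_dist[OF g])
  also have "\<dots> = norm (\<delta> (\<gamma> 0))" by (simp add: zero)
  also have "\<dots> \<le> norm (C (\<gamma> 0)) + norm (\<delta> 0)"
    using lin_apply[of \<delta> "\<gamma> 0"] norm_triangle_ineq by (metis C_def)
  finally have u: "norm u \<le> norm (\<gamma> 0) + norm (\<delta> 0)"
    using C by (simp add: orthogonal_transformation_norm)
  have "\<gamma> (\<delta> u) = B (C u) + B (\<delta> 0) + \<gamma> 0"
    using B lin_apply[of \<gamma> "\<delta> u"] lin_apply[of \<delta> u]
    by (simp add: B_def C_def orthogonal_transformation_linear linear_add)
  moreover have "0 = C (B u) + C (\<gamma> 0) + \<delta> 0"
    using C lin_apply[of \<delta> "\<gamma> u"] lin_apply[of \<gamma> u] zero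
    by (simp add: B_def C_def orthogonal_transformation_linear linear_add)
  ultimately have "commut \<gamma> \<delta> 0 =
      (B (C u) - C (B u)) + (B (\<delta> 0) - \<delta> 0) - (C (\<gamma> 0) - \<gamma> 0)"
    by (simp add: commut_def u_def algebra_simps)
  then have "norm (commut \<gamma> \<delta> 0) =
      norm ((B (C u) - C (B u)) + (B (\<delta> 0) - \<delta> 0) - (C (\<gamma> 0) - \<gamma> 0))" by (rule arg_cong)
  then have "norm (commut \<gamma> \<delta> 0) \<le>
      norm (B (C u) - C (B u)) + norm (B (\<delta> 0) - \<delta> 0) + norm (C (\<gamma> 0) - \<gamma> 0)"
    using norm_triangle_ineq4[of "(B (C u) - C (B u)) + (B (\<delta> 0) - \<delta> 0)" "C (\<gamma> 0) - \<gamma> 0"]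
      norm_triangle_ineq[of "B (C u) - C (B u)" "B (\<delta> 0) - \<delta> 0"] by linarith
  moreover have "norm (B (C u) - C (B u)) \<le> 2 * \<beta> * \<eta> * norm u"
    using nB nC pos B C
    by (intro norm_commutator_diff_le) (simp_all add: orthogonal_transformation_linear B_def C_def)
  moreover have "2 * \<beta> * \<eta> * norm u \<le> 2 * \<beta> * \<eta> * (norm (\<gamma> 0) + norm (\<delta> 0))"
    using u pos by (intro mult_left_mono) auto
  moreover have "norm (B (\<delta> 0) - \<delta> 0) \<le> \<beta> * norm (\<delta> 0)" "norm (C (\<gamma> 0) - \<gamma> 0) \<le> \<eta> * norm (\<gamma> 0)"
    using nB nC unfolding near_def B_def C_def by auto
  ultimately show ?thesis by linarith
qed

section \<open>Discrete groups\<close>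

lemma isom_groupD:
  assumes "isom_group \<Gamma>"
  shows "\<gamma> \<in> \<Gamma> \<Longrightarrow> isometry_E \<gamma>" "id \<in> \<Gamma>" "\<gamma> \<in> \<Gamma> \<Longrightarrow> \<delta> \<in> \<Gamma> \<Longrightarrow> \<gamma> \<circ> \<delta> \<in> \<Gamma>"
    "\<gamma> \<in> \<Gamma> \<Longrightarrow> inv \<gamma> \<in> \<Gamma>"
  using assms unfolding isom_group_def by auto

lemma funpow_in_isom_group:
  assumes "isom_group \<Gamma>" "\<gamma> \<in> \<Gamma>" shows "\<gamma> ^^ k \<in> \<Gamma>"
proof (induction k)
  case 0 then show ?case using isom_groupD(2)[OF assms(1)] unfolding funpow.simps .
next
  case (Suc k) then show ?case using isom_groupD(3)[OF assms] unfolding funpow.simps by blast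
qed

lemma lin_commut:
  assumes "isom_group \<Gamma>" "\<gamma> \<in> \<Gamma>" "\<delta> \<in> \<Gamma>"
  shows "lin (commut \<gamma> \<delta>) = commut (lin \<gamma>) (lin \<delta>)" "commut \<gamma> \<delta> \<in> \<Gamma>"
proof -
  note G = isom_groupD[OF assms(1)]
  show "commut \<gamma> \<delta> \<in> \<Gamma>" unfolding commut_def by (intro G assms)
  show "lin (commut \<gamma> \<delta>) = commut (lin \<gamma>) (lin \<delta>)"
    unfolding commut_def using G assms by (simp add: lin_compose lin_inv)
qed

text \<open>Discreteness at the identity, restated through displacements of the linear part so that
  the commutator estimates apply to it.\<close>

lemma discrete_near_id:
  fixes \<Gamma> :: "'n::finite isom set"
  assumes "discrete_isom_group \<Gamma>"
  obtains e where "e > 0" "\<And>\<gamma>. \<gamma> \<in> \<Gamma> \<Longrightarrow> near e (lin \<gamma>) \<Longrightarrow> norm (\<gamma> 0) \<le> e \<Longrightarrow> \<gamma> = id"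
proof -
  have grp: "isom_group \<Gamma>" using assms unfolding discrete_isom_group_def by blast
  note G = isom_groupD[OF grp]
  obtain r where r: "r > 0" "\<And>\<delta>. \<delta> \<in> \<Gamma> \<Longrightarrow>
      dist (ort \<delta>, transl_part \<delta>) (ort id, transl_part id) < r \<Longrightarrow> \<delta> = id"
    using assms G(2) unfolding discrete_isom_group_def by blast
  define N where "N = real CARD('n) * real CARD('n)"
  have N: "N \<ge> 0" by (simp add: N_def)
  \<comment> \<open>Passing from columns to the matrix costs a factor \<open>N\<close>, the
    translation part adds one more \<open>e\<close>, and the 2 makes the final inequality
    strict.\<close>
  define e where "e = r / (2 * (N + 1))"
  have e: "e > 0" using r N by (simp add: e_def)
  have "\<gamma> = id" if g: "\<gamma> \<in> \<Gamma>" "near e (lin \<gamma>)" "norm (\<gamma> 0) \<le> e" for \<gamma>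
  proof (rule r(2)[OF g(1)])
    have "norm ((ort \<gamma> - ort id) *v axis j 1) \<le> e" for j
    proof -
      have "(ort \<gamma> - ort id) *v axis j 1 = lin \<gamma> (axis j 1) - axis j 1"
        using G(1)[OF g(1)] G(1)[OF G(2)]
        by (simp add: matrix_vector_mult_diff_rdistrib ort_mult) (simp add: lin_def)
      then show ?thesis using g(2) unfolding near_def by (metis mult.right_neutral norm_axis_1)
    qed
    then have "norm (ort \<gamma> - ort id) \<le> N * e" unfolding N_def by (rule norm_matrix_le_columns)
    moreover have "dist (ort \<gamma>, transl_part \<gamma>) (ort id, transl_part id) \<le>
        norm (ort \<gamma> - ort id) + norm (\<gamma> 0)"
      using norm_Pair_le[of "ort \<gamma> - ort id" "\<gamma> 0"] by (simp add: dist_norm transl_part_def)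
    ultimately have "dist (ort \<gamma>, transl_part \<gamma>) (ort id, transl_part id) \<le> (N + 1) * e"
      using g(3) by (simp add: algebra_simps)
    also have "\<dots> = r / 2" using N by (simp add: e_def divide_simps)
    also have "\<dots> < r" using r(1) by simp
    finally show "dist (ort \<gamma>, transl_part \<gamma>) (ort id, transl_part id) < r" .
  qed
  with e show ?thesis using that by blast
qed

text \<open>Linear and translation parts stay in a bounded set, so infinitely many elements would
  include two distinct ones that are arbitrarily close. Their quotient is then near the identity,
  hence equal to it.\<close>

lemma discrete_locally_finite:
  fixes \<Gamma> :: "'n::finite isom set"
  assumes "discrete_isom_group \<Gamma>"
  shows "finite {\<gamma>\<in>\<Gamma>. norm (\<gamma> 0) \<le> R}"
proof (rule ccontr)
  assume inf: "infinite {\<gamma>\<in>\<Gamma>. norm (\<gamma> 0) \<le> R}"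
  have grp: "isom_group \<Gamma>" using assms unfolding discrete_isom_group_def by blast
  note G = isom_groupD[OF grp]
  obtain e where e: "e > 0" "\<And>\<gamma>. \<gamma> \<in> \<Gamma> \<Longrightarrow> near e (lin \<gamma>) \<Longrightarrow> norm (\<gamma> 0) \<le> e \<Longrightarrow> \<gamma> = id"
    using discrete_near_id[OF assms] by blast
  define f :: "'n isom \<Rightarrow> (real^'n^'n) \<times> (real^'n)" where "f = (\<lambda>\<gamma>. (ort \<gamma>, \<gamma> 0))"
  let ?F = "{\<gamma>\<in>\<Gamma>. norm (\<gamma> 0) \<le> R}"
  have "inj_on f \<Gamma>"
  proof (rule inj_onI)
    fix \<gamma> \<delta> assume "\<gamma> \<in> \<Gamma>" "\<delta> \<in> \<Gamma>" "f \<gamma> = f \<delta>"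
    then have "lin \<gamma> = lin \<delta>" "\<gamma> 0 = \<delta> 0" using ort_eq_iff G(1) by (auto simp: f_def)
    then have "\<gamma> x = \<delta> x" for x using lin_apply[of \<gamma> x] lin_apply[of \<delta> x] by simp
    then show "\<gamma> = \<delta>" by (rule ext)
  qed
  then have "infinite (f ` ?F)" using inf by (metis (no_types, lifting) finite_image_iff inj_on_subset mem_Collect_eq subsetI)
  moreover have "bounded (f ` ?F)"
  proof (rule boundedI)
    fix p assume "p \<in> f ` ?F"
    then obtain \<gamma> where g: "\<gamma> \<in> \<Gamma>" "norm (\<gamma> 0) \<le> R" "p = (ort \<gamma>, \<gamma> 0)" by (auto simp: f_def)
    have "norm (ort \<gamma>) \<le> real CARD('n) * real CARD('n)"
      using norm_orthogonal_matrix_le[OF orthogonal_lin[OF G(1)[OF g(1)]]] by (simp add: ort_def lin_def)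
    then show "norm p \<le> real CARD('n) * real CARD('n) + R"
      using g norm_Pair_le[of "ort \<gamma>" "\<gamma> 0"] by simp
  qed
  ultimately have "\<exists>p\<in>f ` ?F. infinite (f ` ?F \<inter> ball p e)"
    using e(1) by (rule infinite_bounded_cluster)
  then obtain p where p: "p \<in> f ` ?F" "infinite (f ` ?F \<inter> ball p e)" ..
  have "f ` ?F \<inter> ball p e - {p} \<noteq> {}" by (rule infinite_imp_nonempty[OF infinite_remove[OF p(2)]])
  then obtain q where "q \<in> f ` ?F \<inter> ball p e - {p}" by (meson ex_in_conv)
  then have q: "q \<in> f ` ?F" "dist p q < e" "q \<noteq> p" by (simp_all only: Int_iff Diff_iff mem_ball insert_iff empty_iff simp_thms)
  obtain \<gamma> \<delta> where gd: "\<gamma> \<in> \<Gamma>" "\<delta> \<in> \<Gamma>" "p = f \<gamma>" "q = f \<delta>" using p q by auto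
  have iso: "isometry_E \<gamma>" "isometry_E \<delta>" "isometry_E (inv \<gamma>)" using G gd by auto
  have "norm (ort \<delta> - ort \<gamma>) \<le> e"
    using q(2) dist_fst_le[of p q] unfolding gd f_def by (simp add: dist_norm norm_minus_commute)
  then have "near e (inv (lin \<gamma>) \<circ> lin \<delta>)"
    using near_inv_compose[OF orthogonal_lin[OF iso(1)] orthogonal_lin[OF iso(2)]]
    by (simp add: ort_def lin_def)
  then have "near e (lin (inv \<gamma> \<circ> \<delta>))" using lin_compose lin_inv iso by metis
  moreover have "norm ((inv \<gamma> \<circ> \<delta>) 0) \<le> e"
  proof -
    have "norm ((inv \<gamma> \<circ> \<delta>) 0) = norm (\<gamma> (inv \<gamma> (\<delta> 0)) - \<gamma> 0)"
      using isometry_E_dist[OF iso(1), of _ 0] by simp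
    also have "\<dots> = norm (\<delta> 0 - \<gamma> 0)" using isometry_E_inv_cancel[OF iso(1)] by simp
    also have "\<dots> \<le> e"
      using q(2) dist_snd_le[of p q] unfolding gd f_def by (simp add: dist_norm norm_minus_commute)
    finally show ?thesis .
  qed
  ultimately have "inv \<gamma> \<circ> \<delta> = id" using e(2)[OF G(3)[OF G(4)[OF gd(1)] gd(2)]] by simp
  then have "inv \<gamma> (\<delta> x) = x" for x by (simp add: fun_eq_iff)
  then have "\<gamma> x = \<delta> x" for x using isometry_E_inv_cancel(1)[OF iso(1), of "\<delta> x"] by simp
  then have "\<gamma> = \<delta>" by (rule ext)
  then show False using q(3) gd by simp
qed

text \<open>An infinite point group would have infinitely many matrices close to one
  \<open>ort \<gamma>\<close>. Each of them is \<open>ort \<gamma>\<close> times a matrix coming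
  from an element near the identity, and there are finitely many of those.\<close>

lemma finite_ort_if_finite_near:
  fixes \<Gamma> :: "'n::finite isom set"
  assumes grp: "isom_group \<Gamma>" and "e > 0" and fin: "finite (ort ` {\<gamma>\<in>\<Gamma>. near e (lin \<gamma>)})"
  shows "finite (ort ` \<Gamma>)"
proof (rule ccontr)
  assume "infinite (ort ` \<Gamma>)"
  note G = isom_groupD[OF grp]
  have "bounded (ort ` \<Gamma>)"
  proof (rule boundedI)
    fix p assume "p \<in> ort ` \<Gamma>"
    then show "norm p \<le> real CARD('n) * real CARD('n)"
      using norm_orthogonal_matrix_le orthogonal_lin G(1) by (auto simp: ort_def lin_def)
  qed
  then obtain p where p: "p \<in> ort ` \<Gamma>" "infinite (ort ` \<Gamma> \<inter> ball p e)"
    using infinite_bounded_cluster \<open>infinite (ort ` \<Gamma>)\<close> assms(2) by blast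
  then obtain \<gamma> where g: "\<gamma> \<in> \<Gamma>" "p = ort \<gamma>" by auto
  have iso: "isometry_E \<gamma>" using G g by auto
  have "ort ` \<Gamma> \<inter> ball p e \<subseteq> (\<lambda>M. ort \<gamma> ** M) ` (ort ` {\<gamma>\<in>\<Gamma>. near e (lin \<gamma>)})"
  proof
    fix q assume "q \<in> ort ` \<Gamma> \<inter> ball p e"
    then obtain \<delta> where d: "\<delta> \<in> \<Gamma>" "q = ort \<delta>" "norm (ort \<delta> - ort \<gamma>) \<le> e"
      by (auto simp: g dist_norm norm_minus_commute)
    have isod: "isometry_E \<delta>" using G d by auto
    let ?h = "inv \<gamma> \<circ> \<delta>"
    have h: "?h \<in> \<Gamma>" using G d g by auto
    have lh: "lin ?h = inv (lin \<gamma>) \<circ> lin \<delta>" using lin_compose lin_inv iso G g by metis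
    have "near e (lin ?h)" unfolding lh
      using near_inv_compose[OF orthogonal_lin[OF iso] orthogonal_lin[OF isod]] d(3)
      by (simp add: ort_def lin_def)
    moreover have "ort \<delta> = ort \<gamma> ** ort ?h"
    proof -
      have "ort \<delta> *v x = (ort \<gamma> ** ort ?h) *v x" for x
        using G(1)[OF h] iso isod lh
        by (simp add: matrix_vector_mul_assoc[symmetric] ort_mult orthogonal_inv_cancel orthogonal_lin)
      then show ?thesis by (simp add: matrix_eq)
    qed
    ultimately show "q \<in> (\<lambda>M. ort \<gamma> ** M) ` (ort ` {\<gamma>\<in>\<Gamma>. near e (lin \<gamma>)})"
      using h d(2) by blast
  qed
  then show False using p(2) fin finite_subset by blast
qed

section \<open>Recurrence of powers and iterated commutators\<close>

text \<open>By compactness two different powers of \<open>A\<close> are close, and their quotient is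
  again a power. A positive exponent is needed later so that the matching power of the expansion
  factor still exceeds 1.\<close>

lemma orthogonal_power_near_id:
  fixes A :: "'n::finite isom"
  assumes A: "orthogonal_transformation A" and "e > 0"
  shows "\<exists>k>0. near e (A ^^ k)"
proof -
  have "bounded (range (\<lambda>k. matrix (A ^^ k)))"
  proof (rule boundedI)
    fix M assume "M \<in> range (\<lambda>k. matrix (A ^^ k))"
    then show "norm M \<le> real CARD('n) * real CARD('n)"
      using norm_orthogonal_matrix_le[OF orthogonal_funpow[OF A]] by (elim rangeE) simp
  qed
  then obtain l r where r: "strict_mono (r :: nat \<Rightarrow> nat)"
      "((\<lambda>k. matrix (A ^^ k)) \<circ> r) \<longlonglongrightarrow> l"
    using bounded_imp_convergent_subsequence[of "\<lambda>k. matrix (A ^^ k)"] by metis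
  then have "Cauchy ((\<lambda>k. matrix (A ^^ k)) \<circ> r)" by (intro LIMSEQ_imp_Cauchy)
  then obtain N where N: "\<And>m n. m \<ge> N \<Longrightarrow> n \<ge> N \<Longrightarrow>
      norm (matrix (A ^^ r m) - matrix (A ^^ r n)) < e"
    using assms(2) unfolding Cauchy_iff comp_apply by meson
  define i j where "i = r N" and "j = r (Suc N)"
  have ij: "i < j" using r(1) by (simp add: i_def j_def strict_mono_Suc_iff)
  have "near e (inv (A ^^ i) \<circ> (A ^^ j))"
    using N[of "Suc N" N] by (intro near_inv_compose orthogonal_funpow A) (simp add: i_def j_def)
  moreover have "inv (A ^^ i) \<circ> (A ^^ j) = A ^^ (j - i)"
  proof -
    have "A ^^ j = A ^^ i \<circ> A ^^ (j - i)" using ij by (metis funpow_add le_add_diff_inverse less_imp_le)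
    then show ?thesis using orthogonal_inv_cancel[OF orthogonal_funpow[OF A]] by (simp add: fun_eq_iff)
  qed
  ultimately show ?thesis using ij by (metis zero_less_diff)
qed

text \<open>The iterated commutators of a nearly translational \<open>\<gamma>\<close> with \<open>\<delta>\<close> contract to the
  identity, rotational and translational parts alike, so by discreteness they reach it.\<close>
lemma iterated_commut_eq_id:
  fixes \<Gamma> :: "'n::finite isom set"
  assumes disc: "discrete_isom_group \<Gamma>" and g: "\<gamma> \<in> \<Gamma>" and d: "\<delta> \<in> \<Gamma>"
    and ng: "near (1/8) (lin \<gamma>)" and nd: "near 1 (lin \<delta>)"
  shows "\<exists>i. (commut \<gamma> ^^ i) \<delta> = id"
proof -
  have grp: "isom_group \<Gamma>" using disc unfolding discrete_isom_group_def by blast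
  note G = isom_groupD[OF grp]
  define s where "s = (\<lambda>i. (commut \<gamma> ^^ i) \<delta>)"
  \<comment> \<open>The weight 10 gives \<open>5/4 * norm (\<gamma> 0) \<le> M / 8\<close>. Together
    with the coefficient \<open>3/8 = 1/4 + 1/8\<close> of the previous translation part, this makes
    translation parts halve at each step.\<close>
  define M where "M = norm (\<delta> 0) + 10 * norm (\<gamma> 0)"
  have s: "s i \<in> \<Gamma> \<and> near ((1/4)^i) (lin (s i)) \<and> norm (s i 0) \<le> (1/2)^i * M" for i
  proof (induction i)
    case 0 then show ?case using d nd by (simp add: s_def M_def)
  next
    case (Suc i)
    then have i: "s i \<in> \<Gamma>" "near ((1/4)^i) (lin (s i))" "norm (s i 0) \<le> (1/2)^i * M" by auto
    have S: "s (Suc i) = commut \<gamma> (s i)" by (simp add: s_def)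
    note iso = G(1)[OF g] G(1)[OF i(1)]
    have "near (2 * (1/8) * (1/4)^i) (lin (s (Suc i)))"
      unfolding S lin_commut(1)[OF grp g i(1)]
      by (rule near_commut) (use iso orthogonal_lin ng i in auto)
    then have 1: "near ((1/4)^Suc i) (lin (s (Suc i)))" by simp
    have "norm (s (Suc i) 0) \<le> 2 * (1/8) * (1/4)^i * (norm (\<gamma> 0) + norm (s i 0))
        + 1/8 * norm (s i 0) + (1/4)^i * norm (\<gamma> 0)"
      unfolding S by (rule norm_commut_0_le) (use iso ng i in auto)
    also have "\<dots> = (1/4)^i * (5/4 * norm (\<gamma> 0)) + (1/4)^i * (1/4 * norm (s i 0)) + 1/8 * norm (s i 0)"
      by (simp add: field_simps)
    also have "\<dots> \<le> (1/2)^i * (5/4 * norm (\<gamma> 0)) + 1 * (1/4 * norm (s i 0)) + 1/8 * norm (s i 0)"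
      by (intro add_mono mult_right_mono power_mono power_le_one) auto
    also have "\<dots> \<le> (1/2)^i * (5/4 * norm (\<gamma> 0)) + 3/8 * ((1/2)^i * M)"
      using i(3) by simp
    also have "\<dots> \<le> (1/2)^i * (1/8 * M) + 3/8 * ((1/2)^i * M)"
      by (intro add_mono mult_left_mono) (auto simp: M_def)
    finally have "norm (s (Suc i) 0) \<le> (1/2)^Suc i * M" by (simp add: algebra_simps)
    with 1 show ?case unfolding S using lin_commut(2)[OF grp g i(1)] by auto
  qed
  obtain e where e: "e > 0" "\<And>\<gamma>. \<gamma> \<in> \<Gamma> \<Longrightarrow> near e (lin \<gamma>) \<Longrightarrow> norm (\<gamma> 0) \<le> e \<Longrightarrow> \<gamma> = id"
    using discrete_near_id[OF disc] by blast
  have "M \<ge> 0" by (simp add: M_def)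
  \<comment> \<open>\<open>M + 1\<close> is positive and dominates both 1 and \<open>M\<close>, so
    one \<open>i\<close> handles the linear and the translation part.\<close>
  obtain i where i: "(1/2)^i < e / (M + 1)"
    using real_arch_pow_inv[of "e / (M+1)" "1/2"] e(1) \<open>M \<ge> 0\<close> by auto
  then have iM: "(1/2)^i * (M + 1) < e" using \<open>M \<ge> 0\<close> by (simp add: field_simps)
  have "(1/4::real)^i \<le> (1/2)^i" by (intro power_mono) auto
  moreover have "(1/2::real)^i \<le> (1/2)^i * (M + 1)" "(1/2)^i * M \<le> (1/2)^i * (M + 1)"
    using \<open>M \<ge> 0\<close> by (simp_all add: algebra_simps)
  ultimately have "(1/4::real)^i \<le> e" "(1/2)^i * M \<le> e" using iM by linarith+
  moreover have "near e (lin (s i))"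
    using s[of i] \<open>(1/4::real)^i \<le> e\<close> unfolding near_def
    by (meson mult_right_mono norm_ge_zero order_trans)
  ultimately have "s i = id" using e(2) s[of i] by fastforce
  then show ?thesis by (auto simp: s_def)
qed

text \<open>Every iterate stays within \<open>1/4\<close> of the identity, so
  \<open>commut_eq_id_descend\<close> strips off one commutator at a time until only
  \<open>commut B X\<close> is left.\<close>

lemma commut_eq_id_if_iterated:
  fixes B X :: "'n::finite isom"
  assumes B: "orthogonal_transformation B" "near (1/8) B"
    and X: "orthogonal_transformation X" "near (1/4) X"
    and "(commut B ^^ Suc i) X = id"
  shows "commut B X = id"
proof -
  have s: "orthogonal_transformation ((commut B ^^ j) X) \<and> near (1/4) ((commut B ^^ j) X)" for j
  proof (induction j)
    case (Suc j)
    have "near (2 * (1/8) * (1/4)) (commut B ((commut B ^^ j) X))"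
      by (rule near_commut) (use B Suc in auto)
    then have "near (1/4) (commut B ((commut B ^^ j) X))" unfolding near_def
    proof (intro allI, goal_cases)
      case (1 v)
      then have "norm (commut B ((commut B ^^ j) X) v - v) \<le> 2 * (1/8) * (1/4) * norm v" by blast
      then show ?case using norm_ge_zero[of v] by linarith
    qed
    then show ?case using orthogonal_commut[OF B(1)] Suc by simp
  qed (use X in simp)
  show ?thesis using assms(5)
  proof (induction i)
    case (Suc i)
    from Suc.prems have "commut B (commut B ((commut B ^^ i) X)) = id" by (simp only: funpow.simps o_apply)
    then have "commut B ((commut B ^^ i) X) = id"
      using commut_eq_id_descend[OF B(1), of "(commut B ^^ i) X"] s[of i] by blast
    then show ?case using Suc.IH by (simp only: funpow.simps o_apply)
  qed simp
qed

section \<open>Translations\<close>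

definition transl_vectors :: "'n::finite isom set \<Rightarrow> (real^'n) set" where
  "transl_vectors \<Gamma> = {t. (\<lambda>x. x + t) \<in> \<Gamma>}"

lemma transl_vectors_subgroup:
  assumes "isom_group \<Gamma>"
  shows "0 \<in> transl_vectors \<Gamma>" "s \<in> transl_vectors \<Gamma> \<Longrightarrow> t \<in> transl_vectors \<Gamma> \<Longrightarrow> s + t \<in> transl_vectors \<Gamma>"
    "t \<in> transl_vectors \<Gamma> \<Longrightarrow> - t \<in> transl_vectors \<Gamma>"
proof -
  note G = isom_groupD[OF assms]
  show "0 \<in> transl_vectors \<Gamma>" using G(2) by (simp add: transl_vectors_def id_def)
  show "s + t \<in> transl_vectors \<Gamma>" if "s \<in> transl_vectors \<Gamma>" "t \<in> transl_vectors \<Gamma>"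
  proof -
    have "(\<lambda>x. x + t) \<circ> (\<lambda>x. x + s) \<in> \<Gamma>" using G(3) that by (auto simp: transl_vectors_def)
    then show ?thesis by (simp add: transl_vectors_def o_def add.assoc)
  qed
  show "- t \<in> transl_vectors \<Gamma>" if "t \<in> transl_vectors \<Gamma>"
  proof -
    have "inv (\<lambda>x. x + t) = (\<lambda>x. x - t)" by (rule inv_equality) auto
    then show ?thesis using G(4)[of "\<lambda>x. x + t"] that by (simp add: transl_vectors_def)
  qed
qed

text \<open>Take a basis of the span inside \<open>T\<close> and round the coordinates of
  \<open>x\<close> down to integers. The error has coordinates in [0, 1), so the sum of the norms of
  the basis vectors bounds it.\<close>

lemma additive_subgroup_cobounded_in_span:
  fixes T :: "'a::euclidean_space set"
  assumes T0: "0 \<in> T" and Tadd: "\<And>s t. s \<in> T \<Longrightarrow> t \<in> T \<Longrightarrow> s + t \<in> T" and Tm: "\<And>t. t \<in> T \<Longrightarrow> - t \<in> T"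
  shows "\<exists>R. \<forall>x\<in>span T. \<exists>t\<in>T. norm (x - t) \<le> R"
proof -
  obtain B where B: "B \<subseteq> T" "independent B" "T \<subseteq> span B" using basis_exists[of T] by metis
  have fB: "finite B" using B(2) by (rule independent_imp_finite)
  have natmul: "real n *\<^sub>R t \<in> T" if "t \<in> T" for n t
    by (induction n) (auto simp: T0 Tadd that scaleR_left_distrib)
  have intmul: "real_of_int m *\<^sub>R t \<in> T" if t: "t \<in> T" for m t
  proof (cases "m \<ge> 0")
    case True then show ?thesis using natmul[OF t, of "nat m"] by simp
  next
    case False then show ?thesis using Tm[OF natmul[OF t, of "nat (- m)"]] by simp
  qed
  have sumT: "(\<Sum>b\<in>C. f b) \<in> T" if "finite C" "\<And>b. b \<in> C \<Longrightarrow> f b \<in> T" for C and f :: "'a \<Rightarrow> 'a"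
    using that by (induction C) (auto simp: T0 Tadd)
  show ?thesis
  proof (intro exI ballI)
    fix x assume "x \<in> span T"
    then have "x \<in> span B" using B(3) by (meson span_minimal subsetD subspace_span)
    then obtain u where u: "x = (\<Sum>b\<in>B. u b *\<^sub>R b)" using span_finite[OF fB] by auto
    define t where "t = (\<Sum>b\<in>B. real_of_int \<lfloor>u b\<rfloor> *\<^sub>R b)"
    have "t \<in> T" unfolding t_def using B(1) by (intro sumT fB intmul) auto
    moreover have "norm (x - t) \<le> (\<Sum>b\<in>B. norm b)"
    proof -
      have "x - t = (\<Sum>b\<in>B. frac (u b) *\<^sub>R b)"
        by (simp add: u t_def sum_subtractf[symmetric] frac_def algebra_simps)
      also have "norm \<dots> \<le> (\<Sum>b\<in>B. norm b)"
      proof (rule sum_norm_le)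
        fix b
        have "\<bar>frac (u b)\<bar> * norm b \<le> 1 * norm b"
          using frac_lt_1[of "u b"] frac_ge_0[of "u b"] by (intro mult_right_mono) auto
        then show "norm (frac (u b) *\<^sub>R b) \<le> norm b" by simp
      qed
      finally show ?thesis .
    qed
    ultimately show "\<exists>t\<in>T. norm (x - t) \<le> (\<Sum>b\<in>B. norm b)" by blast
  qed
qed

text \<open>The bridge from the matrix condition in \<open>transl_subgroup\<close> to an additive
  group of vectors: an isometry with identity linear part adds its value at 0 to every
  point.\<close>

lemma transl_subgroup_eq:
  fixes \<Gamma> :: "'n::finite isom set"
  assumes "isom_group \<Gamma>"
  shows "transl_subgroup \<Gamma> = (\<lambda>t x. x + t) ` transl_vectors \<Gamma>"
proof -
  note G = isom_groupD[OF assms]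
  have lid: "lin (id :: 'n isom) = id" by (simp add: lin_def fun_eq_iff)
  have oid: "ort (id :: 'n isom) = mat 1" by (simp add: ort_def id_def matrix_id_mat_1[unfolded id_def])
  have lt: "lin (\<lambda>x. x + t) = id" for t :: "real^'n" by (simp add: lin_def fun_eq_iff)
  show ?thesis
  proof (intro equalityI subsetI)
    fix \<gamma> assume "\<gamma> \<in> transl_subgroup \<Gamma>"
    then have g: "\<gamma> \<in> \<Gamma>" "ort \<gamma> = ort id" using oid by (auto simp: transl_subgroup_def)
    then have "lin \<gamma> = id" using ort_eq_iff[OF G(1)[OF g(1)] G(1)[OF G(2)]] lid by simp
    then have "\<gamma> x = x + \<gamma> 0" for x using lin_apply[of \<gamma> x] by simp
    then have eq: "\<gamma> = (\<lambda>x. x + \<gamma> 0)" by (rule ext)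
    then have "\<gamma> 0 \<in> transl_vectors \<Gamma>" using g(1) unfolding transl_vectors_def by simp
    then show "\<gamma> \<in> (\<lambda>t x. x + t) ` transl_vectors \<Gamma>" using eq by blast
  next
    fix \<gamma> assume "\<gamma> \<in> (\<lambda>t x. x + t) ` transl_vectors \<Gamma>"
    then have g: "\<gamma> \<in> \<Gamma>" "lin \<gamma> = id" using lt by (auto simp: transl_vectors_def)
    then have "ort \<gamma> = ort id" using ort_eq_iff[OF G(1)[OF g(1)] G(1)[OF G(2)]] lid by simp
    then show "\<gamma> \<in> transl_subgroup \<Gamma>" using g(1) oid by (auto simp: transl_subgroup_def)
  qed
qed

lemma subgroup_of_isom_group:
  assumes "isom_group \<Gamma>" "subgroup_of G \<Gamma>" shows "isom_group G"
  using assms unfolding isom_group_def subgroup_of_def by auto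

lemma subgroup_transl_subgroup:
  fixes \<Gamma> :: "'n::finite isom set"
  assumes "isom_group \<Gamma>"
  shows "subgroup_of (transl_subgroup \<Gamma>) \<Gamma>"
proof -
  note T = transl_vectors_subgroup[OF assms]
  have i: "inv (\<lambda>x. x + t) = (\<lambda>x. x + - t)" for t :: "real^'n" by (rule inv_equality) auto
  show ?thesis
    unfolding subgroup_of_def
  proof (intro conjI ballI)
    show "transl_subgroup \<Gamma> \<subseteq> \<Gamma>" by (auto simp: transl_subgroup_def)
    show "id \<in> transl_subgroup \<Gamma>" unfolding transl_subgroup_eq[OF assms] using T(1)
      by (intro image_eqI[of _ _ 0]) auto
  next
    fix g h assume "g \<in> transl_subgroup \<Gamma>" "h \<in> transl_subgroup \<Gamma>"
    then obtain s t where "s \<in> transl_vectors \<Gamma>" "t \<in> transl_vectors \<Gamma>" "g = (\<lambda>x. x + s)" "h = (\<lambda>x. x + t)"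
      unfolding transl_subgroup_eq[OF assms] by auto
    then show "g \<circ> h \<in> transl_subgroup \<Gamma>" unfolding transl_subgroup_eq[OF assms] using T(2)[of t s]
      by (intro image_eqI[of _ _ "t + s"]) (auto simp: add.assoc)
  next
    fix g assume "g \<in> transl_subgroup \<Gamma>"
    then obtain s where "s \<in> transl_vectors \<Gamma>" "g = (\<lambda>x. x + s)"
      unfolding transl_subgroup_eq[OF assms] by auto
    then show "inv g \<in> transl_subgroup \<Gamma>" unfolding transl_subgroup_eq[OF assms] using T(3)[of s] i
      by blast
  qed
qed

text \<open>The compact set is a ball of the span, with radius from
  \<open>additive_subgroup_cobounded_in_span\<close>. The ambient \<Delta> is kept general because
  the pair serves both \<Gamma> and its translation subgroup.\<close>

lemma cocompact_translation_pair_span: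
  assumes grp: "isom_group \<Gamma>" and sub: "subgroup_of (transl_subgroup \<Gamma>) \<Delta>"
  shows "cocompact_translation_pair \<Delta> (transl_subgroup \<Gamma>) (span (transl_vectors \<Gamma>))"
proof -
  let ?T = "transl_vectors \<Gamma>" let ?V = "span ?T"
  note T = transl_vectors_subgroup[OF grp]
  obtain R where R: "\<And>x. x \<in> ?V \<Longrightarrow> \<exists>t\<in>?T. norm (x - t) \<le> R"
    using additive_subgroup_cobounded_in_span[of ?T] T by blast
  have im: "(\<lambda>x. x + t) ` ?V = ?V" if "t \<in> ?T" for t
  proof
    show "(\<lambda>x. x + t) ` ?V \<subseteq> ?V" using that by (auto intro: span_add span_base)
    show "?V \<subseteq> (\<lambda>x. x + t) ` ?V"
    proof
      fix y assume "y \<in> ?V"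
      then show "y \<in> (\<lambda>x. x + t) ` ?V" using that
        by (intro image_eqI[of _ _ "y - t"]) (auto intro: span_diff span_base)
    qed
  qed
  let ?K = "?V \<inter> cball 0 R"
  have K: "compact ?K" by (intro closed_Int_compact closed_subspace subspace_span compact_cball)
  have cover: "?V = (\<Union>g\<in>transl_subgroup \<Gamma>. g ` ?K)"
  proof (intro equalityI subsetI)
    fix x assume x: "x \<in> ?V"
    obtain t where t: "t \<in> ?T" "norm (x - t) \<le> R" using R[OF x] by blast
    then have "x - t \<in> ?K" using x by (auto intro: span_diff span_base)
    then have "x \<in> (\<lambda>x. x + t) ` ?K" by (intro image_eqI[of _ _ "x - t"]) auto
    then show "x \<in> (\<Union>g\<in>transl_subgroup \<Gamma>. g ` ?K)" using t(1) unfolding transl_subgroup_eq[OF grp] by blast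
  next
    fix x assume "x \<in> (\<Union>g\<in>transl_subgroup \<Gamma>. g ` ?K)"
    then show "x \<in> ?V" using im unfolding transl_subgroup_eq[OF grp] by blast
  qed
  show ?thesis
    unfolding cocompact_translation_pair_def
  proof (intro conjI ballI)
    show "affine ?V" by (simp add: subspace_imp_affine)
    show "?V \<noteq> {}" using span_zero by blast
    show "\<exists>K. compact K \<and> K \<subseteq> ?V \<and> ?V = (\<Union>g\<in>transl_subgroup \<Gamma>. g ` K)" using K cover by blast
  qed (use sub im in \<open>auto simp: transl_subgroup_eq[OF grp]\<close>)
qed

section \<open>Subgroups of finite index\<close>

text \<open>The left cosets of the translation subgroup are the fibres of \<open>ort\<close> on
  \<Gamma>.\<close>

lemma finite_index_transl_subgroup:
  fixes \<Gamma> :: "'n::finite isom set"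
  assumes grp: "isom_group \<Gamma>" and fin: "finite (ort ` \<Gamma>)"
  shows "finite_index (transl_subgroup \<Gamma>) \<Gamma>"
proof -
  note G = isom_groupD[OF grp]
  have coset: "(\<lambda>g. \<gamma> \<circ> g) ` transl_subgroup \<Gamma> = {\<delta>\<in>\<Gamma>. ort \<delta> = ort \<gamma>}" if g: "\<gamma> \<in> \<Gamma>" for \<gamma>
  proof (intro equalityI subsetI)
    fix \<delta> assume "\<delta> \<in> (\<lambda>g. \<gamma> \<circ> g) ` transl_subgroup \<Gamma>"
    then obtain t where t: "t \<in> transl_vectors \<Gamma>" "\<delta> = \<gamma> \<circ> (\<lambda>x. x + t)"
      unfolding transl_subgroup_eq[OF grp] by auto
    then have d: "\<delta> \<in> \<Gamma>" using G g by (auto simp: transl_vectors_def)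
    have "lin \<delta> = lin \<gamma>" unfolding t(2) lin_compose[OF G(1)[OF g]] by (simp add: lin_def fun_eq_iff)
    then show "\<delta> \<in> {\<delta>\<in>\<Gamma>. ort \<delta> = ort \<gamma>}" using ort_eq_iff G(1) d g by auto
  next
    fix \<delta> assume "\<delta> \<in> {\<delta>\<in>\<Gamma>. ort \<delta> = ort \<gamma>}"
    then have d: "\<delta> \<in> \<Gamma>" "lin \<delta> = lin \<gamma>" using ort_eq_iff G(1) g by auto
    let ?h = "inv \<gamma> \<circ> \<delta>"
    have h: "?h \<in> \<Gamma>" using G d g by auto
    have "lin ?h = inv (lin \<gamma>) \<circ> lin \<gamma>" using lin_compose lin_inv G g d by metis
    then have "lin ?h = id" using orthogonal_inv_cancel(2)[OF orthogonal_lin[OF G(1)[OF g]]] by (auto simp: fun_eq_iff)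
    then have "?h x = x + ?h 0" for x using lin_apply[of ?h x] by simp
    then have eq: "?h = (\<lambda>x. x + ?h 0)" by (rule ext)
    then have "?h 0 \<in> transl_vectors \<Gamma>" using h unfolding transl_vectors_def by simp
    then have "?h \<in> transl_subgroup \<Gamma>" using eq unfolding transl_subgroup_eq[OF grp] by blast
    moreover have "\<delta> = \<gamma> \<circ> ?h" using isometry_E_inv_cancel(1)[OF G(1)[OF g]] by (auto simp: fun_eq_iff)
    ultimately show "\<delta> \<in> (\<lambda>g. \<gamma> \<circ> g) ` transl_subgroup \<Gamma>" by blast
  qed
  have "(\<lambda>\<gamma>. (\<lambda>g. \<gamma> \<circ> g) ` transl_subgroup \<Gamma>) ` \<Gamma> \<subseteq> (\<lambda>M. {\<delta>\<in>\<Gamma>. ort \<delta> = M}) ` (ort ` \<Gamma>)"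
    using coset by blast
  then show ?thesis unfolding finite_index_def using fin finite_subset by blast
qed

lemma finite_index_self:
  assumes "isom_group \<Gamma>" shows "finite_index \<Gamma> \<Gamma>"
proof -
  note G = isom_groupD[OF assms]
  have "(\<lambda>g. \<gamma> \<circ> g) ` \<Gamma> = \<Gamma>" if g: "\<gamma> \<in> \<Gamma>" for \<gamma>
  proof (intro equalityI subsetI)
    fix \<delta> assume d: "\<delta> \<in> \<Gamma>"
    have "\<delta> = \<gamma> \<circ> (inv \<gamma> \<circ> \<delta>)" using isometry_E_inv_cancel(1)[OF G(1)[OF g]] by (auto simp: fun_eq_iff)
    then show "\<delta> \<in> (\<lambda>g. \<gamma> \<circ> g) ` \<Gamma>" using G d g by blast
  qed (use G g in auto)
  then have "(\<lambda>\<gamma>. (\<lambda>g. \<gamma> \<circ> g) ` \<Gamma>) ` \<Gamma> \<subseteq> {\<Gamma>}" by auto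
  then show ?thesis unfolding finite_index_def using finite_subset by blast
qed

section \<open>Independence of the dimension from the pair\<close>

text \<open>Pigeonhole on the cosets of the powers of \<open>g\<close>: two of them coincide, and
  cancelling the smaller power leaves an element of \<open>G\<close>.\<close>

lemma power_in_finite_index_subgroup:
  assumes grp: "isom_group \<Gamma>" and sub: "subgroup_of G \<Gamma>" and fi: "finite_index G \<Gamma>" and g: "g \<in> \<Gamma>"
  shows "\<exists>k>0. g ^^ k \<in> G"
proof -
  note D = isom_groupD[OF grp]
  have pw: "g ^^ i \<in> \<Gamma>" for i by (rule funpow_in_isom_group[OF grp g])
  let ?c = "\<lambda>i. (\<lambda>h. g ^^ i \<circ> h) ` G"
  have "range ?c \<subseteq> (\<lambda>\<gamma>. (\<lambda>g. \<gamma> \<circ> g) ` G) ` \<Gamma>" using pw by auto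
  then have "finite (range ?c)" using fi finite_subset unfolding finite_index_def by blast
  then have "\<not> inj ?c" using finite_imageD infinite_UNIV_nat by blast
  then obtain i j where ij: "i < j" "?c i = ?c j" unfolding inj_def by (metis linorder_neqE_nat)
  have "g ^^ j \<in> ?c j" using sub unfolding subgroup_of_def by (intro image_eqI[of _ _ id]) auto
  then obtain h where h: "h \<in> G" "g ^^ j = g ^^ i \<circ> h" using ij by auto
  have "g ^^ j = g ^^ i \<circ> g ^^ (j - i)" using ij by (metis funpow_add le_add_diff_inverse less_imp_le)
  then have "g ^^ i \<circ> h = g ^^ i \<circ> g ^^ (j - i)" using h by simp
  moreover have "inj (g ^^ i)" using bij_isometry_E[OF D(1)[OF pw]] by (simp add: bij_is_inj)
  ultimately have "h = g ^^ (j - i)" by (simp add: fun_eq_iff inj_eq)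
  then show ?thesis using h ij by (metis zero_less_diff)
qed

text \<open>Translations induced on \<open>V\<close> by \<open>G\<close> lie in the direction space
  \<open>W\<close> of \<open>V'\<close>. By cocompactness they determine all directions of
  \<open>V\<close>, so a translate of \<open>V\<close> lies inside \<open>V'\<close>.\<close>

lemma fi_pair_aff_dim_le:
  assumes grp: "isom_group \<Gamma>" and p1: "fi_cocompact_translation_pair \<Gamma> G V"
    and p2: "fi_cocompact_translation_pair \<Gamma> G' V'"
  shows "aff_dim V \<le> aff_dim V'"
proof -
  note D = isom_groupD[OF grp]
  have V: "subgroup_of G \<Gamma>" "affine V" "V \<noteq> {}" "\<And>g. g \<in> G \<Longrightarrow> g ` V = V"
      "\<And>g. g \<in> G \<Longrightarrow> \<exists>v. \<forall>x\<in>V. g x = x + v"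
    using p1 unfolding fi_cocompact_translation_pair_def cocompact_translation_pair_def by auto
  obtain K where K: "compact K" "K \<subseteq> V" "V = (\<Union>g\<in>G. g ` K)"
    using p1 unfolding fi_cocompact_translation_pair_def cocompact_translation_pair_def by auto
  have V': "subgroup_of G' \<Gamma>" "finite_index G' \<Gamma>" "affine V'" "V' \<noteq> {}" "\<And>g. g \<in> G' \<Longrightarrow> g ` V' = V'"
      "\<And>g. g \<in> G' \<Longrightarrow> \<exists>v. \<forall>x\<in>V'. g x = x + v"
    using p2 unfolding fi_cocompact_translation_pair_def cocompact_translation_pair_def by auto
  obtain a a' where a: "a \<in> V" "a' \<in> V'" using V(3) V'(4) by blast
  define W where "W = (\<lambda>y. y - a') ` V'"
  have W: "subspace W" using affine_diffs_subspace_subtract[OF V'(3) a(2)] by (simp add: W_def)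
  have vW: "v \<in> W" if g: "g \<in> G" and v: "\<forall>x\<in>V. g x = x + v" for g v
  proof -
    have gG: "g \<in> \<Gamma>" using g V(1) unfolding subgroup_of_def by auto
    obtain k where k: "k > 0" "g ^^ k \<in> G'"
      using power_in_finite_index_subgroup[OF grp V'(1,2) gG] by blast
    obtain w where w: "\<forall>x\<in>V'. (g ^^ k) x = x + w" using V'(6)[OF k(2)] by blast
    have pw: "g ^^ i \<in> \<Gamma>" for i by (rule funpow_in_isom_group[OF grp gG])
    have m1: "(g ^^ m) a = a + real m *\<^sub>R v \<and> (g ^^ m) a \<in> V" for m
    proof (induction m)
      case (Suc m)
      then have "g ((g ^^ m) a) = (g ^^ m) a + v" using v by blast
      then have "(g ^^ Suc m) a = a + real (Suc m) *\<^sub>R v" using Suc by (simp add: algebra_simps)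
      moreover have "(g ^^ Suc m) a \<in> V" using Suc V(4)[OF g] by auto
      ultimately show ?case by blast
    qed (use a in simp)
    have m2: "((g ^^ k) ^^ m) a' = a' + real m *\<^sub>R w \<and> ((g ^^ k) ^^ m) a' \<in> V'" for m
    proof (induction m)
      case (Suc m)
      then have "(g ^^ k) (((g ^^ k) ^^ m) a') = ((g ^^ k) ^^ m) a' + w" using w by blast
      then have "((g ^^ k) ^^ Suc m) a' = a' + real (Suc m) *\<^sub>R w" using Suc by (simp add: algebra_simps)
      moreover have "((g ^^ k) ^^ Suc m) a' \<in> V'" using Suc V'(5)[OF k(2)] by auto
      ultimately show ?case by blast
    qed (use a in simp)
    \<comment> \<open>The orbits of \<open>a\<close> and \<open>a'\<close> under
      \<open>g ^^ k\<close> advance by \<open>real k *\<^sub>R v\<close> and by \<open>w\<close>,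
      yet stay at constant distance since \<open>g\<close> is an isometry. Letting \<open>m\<close>
      grow forces the two steps to agree.\<close>
    have bd: "real m * norm (real k *\<^sub>R v - w) \<le> 2 * norm (a - a')" for m
    proof -
      have "norm ((g ^^ (k * m)) a - (g ^^ (k * m)) a') = norm (a - a')"
        by (rule isometry_E_dist[OF D(1)[OF pw]])
      moreover have "(g ^^ (k * m)) a' = a' + real m *\<^sub>R w" using m2[of m] by (simp add: funpow_mult)
      moreover have "(g ^^ (k * m)) a = a + real m *\<^sub>R (real k *\<^sub>R v)" using m1[of "k * m"] by (simp add: mult.commute)
      ultimately have "norm ((a - a') + real m *\<^sub>R (real k *\<^sub>R v - w)) = norm (a - a')"
        by (simp add: algebra_simps)
      then have "norm (real m *\<^sub>R (real k *\<^sub>R v - w)) \<le> 2 * norm (a - a')"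
        using norm_triangle_ineq4[of "(a - a') + real m *\<^sub>R (real k *\<^sub>R v - w)" "a - a'"] by simp
      then show ?thesis by simp
    qed
    have "real k *\<^sub>R v - w = 0"
    proof (rule ccontr)
      assume "real k *\<^sub>R v - w \<noteq> 0"
      then have "norm (real k *\<^sub>R v - w) > 0" by simp
      then obtain m where "real m * norm (real k *\<^sub>R v - w) > 2 * norm (a - a')"
        using reals_Archimedean3 by blast
      then show False using bd[of m] by simp
    qed
    moreover have "w \<in> W"
    proof -
      have "a' + w \<in> V'" using conjunct1[OF m2[of 1]] conjunct2[OF m2[of 1]] by simp
      then show ?thesis unfolding W_def by (intro image_eqI[of _ _ "a' + w"]) auto
    qed
    ultimately have "(1 / real k) *\<^sub>R (real k *\<^sub>R v) \<in> W" using W by (simp add: subspace_scale)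
    then show ?thesis using k(1) by simp
  qed
  obtain R where R: "\<And>x. x \<in> K \<Longrightarrow> norm x \<le> R" using compact_imp_bounded[OF K(1)] bounded_iff by blast
  have dW: "y - a \<in> W" if y: "y \<in> V" for y
  proof -
    obtain p q where pq: "p \<in> span W" "\<And>w. w \<in> span W \<Longrightarrow> orthogonal q w" "y - a = p + q"
      using orthogonal_subspace_decomp_exists[of W "y - a"] by metis
    have sW: "span W = W" using W by (simp add: span_eq_iff)
    \<comment> \<open>The point \<open>a + m (y - a)\<close> of \<open>V\<close> is a point of the
      bounded set \<open>K\<close> moved by a vector of \<open>W\<close>. Pairing with
      \<open>q\<close>, which is orthogonal to \<open>W\<close>, removes that vector and leaves a
      bound independent of \<open>m\<close>.\<close>
    have bd: "real m * (q \<bullet> q) \<le> norm q * (R + norm a)" for m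
    proof -
      have "(1 - real m) *\<^sub>R a + real m *\<^sub>R y \<in> V" by (rule mem_affine[OF V(2) a(1) y]) simp
      then obtain g \<kappa> where g: "g \<in> G" "\<kappa> \<in> K" "(1 - real m) *\<^sub>R a + real m *\<^sub>R y = g \<kappa>" using K(3) by auto
      obtain v where v: "\<forall>x\<in>V. g x = x + v" using V(5)[OF g(1)] by blast
      have "a + real m *\<^sub>R (p + q) = \<kappa> + v"
        using g v K(2) pq(3)[symmetric] by (auto simp: algebra_simps)
      then have "q \<bullet> (a + real m *\<^sub>R (p + q)) = q \<bullet> (\<kappa> + v)" by simp
      moreover have "q \<bullet> p = 0" "q \<bullet> v = 0" using pq vW[OF g(1) v] unfolding orthogonal_def sW by auto
      ultimately have "real m * (q \<bullet> q) = q \<bullet> (\<kappa> - a)" by (simp add: algebra_simps)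
      also have "\<dots> \<le> norm q * norm (\<kappa> - a)" by (rule norm_cauchy_schwarz)
      also have "\<dots> \<le> norm q * (R + norm a)"
        using R[OF g(2)] norm_triangle_ineq4[of \<kappa> a] by (intro mult_left_mono) auto
      finally show ?thesis .
    qed
    have "q \<bullet> q = 0"
    proof (rule ccontr)
      assume "q \<bullet> q \<noteq> 0"
      then have "q \<bullet> q > 0" by simp
      then obtain m where "real m * (q \<bullet> q) > norm q * (R + norm a)" using reals_Archimedean3 by blast
      then show False using bd[of m] by simp
    qed
    then show ?thesis using pq(1,3) sW by simp
  qed
  have "(+) (a' - a) ` V \<subseteq> V'"
  proof
    fix z assume "z \<in> (+) (a' - a) ` V"
    then obtain y where y: "y \<in> V" "z = (a' - a) + y" by auto
    obtain y' where "y' \<in> V'" "y - a = y' - a'" using dW[OF y(1)] unfolding W_def by auto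
    then show "z \<in> V'" using y(2) by (simp add: algebra_simps)
  qed
  then have "aff_dim ((+) (a' - a) ` V) \<le> aff_dim V'" by (rule aff_dim_subset)
  then show ?thesis by (simp add: aff_dim_translation_eq)
qed

text \<open>The inequality between any two pairs, used in both directions, makes the choice in
  \<open>dim_group\<close> unique, so a single exhibited pair computes it.\<close>

lemma dim_group_eq:
  assumes "isom_group \<Gamma>" "fi_cocompact_translation_pair \<Gamma> G V"
  shows "dim_group \<Gamma> = aff_dim V"
proof -
  have "(SOME d. \<exists>G V. fi_cocompact_translation_pair \<Gamma> G V \<and> aff_dim V = d) = aff_dim V"
  proof (rule some_equality)
    show "\<exists>G W. fi_cocompact_translation_pair \<Gamma> G W \<and> aff_dim W = aff_dim V" using assms(2) by blast
  next
    fix d assume "\<exists>G W. fi_cocompact_translation_pair \<Gamma> G W \<and> aff_dim W = d"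
    then show "d = aff_dim V" using fi_pair_aff_dim_le[OF assms(1)] assms(2) by (meson order_antisym)
  qed
  then show ?thesis by (simp add: dim_group_def)
qed

section \<open>Groups normalised by an expanding map\<close>

text \<open>Conjugation by the \<open>k\<close>-th power of \<open>A\<close>, built up one factor at
  a time. The scaling cancels in the linear part and survives only in the translation part.\<close>

lemma conformal_conjugate:
  fixes \<Gamma> :: "'n::finite isom set"
  assumes grp: "isom_group \<Gamma>" and c: "c > 1" and Q: "orthogonal_transformation Q"
    and A: "A = (\<lambda>x. c *\<^sub>R Q x)" and inv: "\<forall>\<gamma>\<in>\<Gamma>. A \<circ> \<gamma> \<circ> inv A \<in> \<Gamma>" and g: "\<gamma> \<in> \<Gamma>"
  shows "\<exists>\<delta>\<in>\<Gamma>. lin \<delta> = (Q ^^ k) \<circ> lin \<gamma> \<circ> inv (Q ^^ k) \<and> \<delta> 0 = c ^ k *\<^sub>R (Q ^^ k) (\<gamma> 0)"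
proof (induction k)
  case 0 then show ?case using g by (intro bexI[of _ \<gamma>]) (auto simp: fun_eq_iff inv_id[unfolded id_def] simp flip: id_def)
next
  case (Suc k)
  then obtain \<delta> where d: "\<delta> \<in> \<Gamma>" "lin \<delta> = (Q ^^ k) \<circ> lin \<gamma> \<circ> inv (Q ^^ k)"
      "\<delta> 0 = c ^ k *\<^sub>R (Q ^^ k) (\<gamma> 0)" by blast
  have linQ: "linear Q" using Q by (rule orthogonal_transformation_linear)
  have iA: "inv A = (\<lambda>x. inv Q ((1/c) *\<^sub>R x))"
    by (rule inv_equality) (use c in \<open>simp_all add: A orthogonal_inv_cancel Q\<close>)
  have liQ: "linear (inv Q)" using Q orthogonal_transformation_inv orthogonal_transformation_linear by blast
  let ?e = "A \<circ> \<delta> \<circ> inv A"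
  have ld: "linear (lin \<delta>)" using d(1) isom_groupD(1)[OF grp] orthogonal_lin orthogonal_transformation_linear by blast
  have e: "?e = (\<lambda>x. Q (lin \<delta> (inv Q x)) + c *\<^sub>R Q (\<delta> 0))"
  proof
    fix x
    have "?e x = A (\<delta> ((1/c) *\<^sub>R inv Q x))" by (simp add: iA linear_scale[OF liQ])
    also have "\<dots> = c *\<^sub>R Q (\<delta> ((1/c) *\<^sub>R inv Q x))" by (simp add: A)
    also have "\<dots> = c *\<^sub>R Q ((1/c) *\<^sub>R lin \<delta> (inv Q x) + \<delta> 0)"
      using lin_apply[of \<delta> "(1/c) *\<^sub>R inv Q x"] by (simp add: linear_scale[OF ld])
    also have "\<dots> = Q (lin \<delta> (inv Q x)) + c *\<^sub>R Q (\<delta> 0)"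
      using c by (simp add: linear_add[OF linQ] linear_scale[OF linQ] scaleR_add_right)
    finally show "?e x = Q (lin \<delta> (inv Q x)) + c *\<^sub>R Q (\<delta> 0)" .
  qed
  have e0: "?e 0 = c *\<^sub>R Q (\<delta> 0)"
    unfolding e using linear_0[OF linQ] linear_0[OF liQ] linear_0[OF ld] by simp
  have "lin ?e = Q \<circ> lin \<delta> \<circ> inv Q"
    unfolding e using lin_affine[OF linear_compose[OF liQ linear_compose[OF ld linQ]]] by (simp add: o_def)
  moreover have "inv (Q ^^ Suc k) = inv (Q ^^ k) \<circ> inv Q"
    using o_inv_distrib[of Q "Q ^^ k"] orthogonal_transformation_bij[OF Q]
      orthogonal_transformation_bij[OF orthogonal_funpow[OF Q]] by simp
  ultimately have "lin ?e = (Q ^^ Suc k) \<circ> lin \<gamma> \<circ> inv (Q ^^ Suc k)" unfolding d(2) by (simp add: o_assoc)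
  moreover have "?e 0 = c ^ Suc k *\<^sub>R (Q ^^ Suc k) (\<gamma> 0)"
    unfolding e0 d(3) by (simp add: linear_scale[OF linQ])
  ultimately show ?case using inv d(1) by blast
qed

lemma finite_ort_if_expanding:
  fixes \<Gamma> :: "'n::finite isom set"
  assumes disc: "discrete_isom_group \<Gamma>" and exp: "expanding_conformal A"
    and inv: "\<forall>\<gamma>\<in>\<Gamma>. A \<circ> \<gamma> \<circ> inv A \<in> \<Gamma>"
  shows "finite (ort ` \<Gamma>)"
proof -
  have grp: "isom_group \<Gamma>" using disc unfolding discrete_isom_group_def by blast
  note G = isom_groupD[OF grp]
  obtain c Q where cQ: "c > 1" "orthogonal_transformation Q" "A = (\<lambda>x. c *\<^sub>R Q x)"
    using exp unfolding expanding_conformal_def by blast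
  \<comment> \<open>\<open>1/4\<close> is the tolerance of
    \<open>commut_eq_id_if_iterated\<close>.\<close>
  obtain k where k: "k > 0" "near (1/4) (Q ^^ k)" using orthogonal_power_near_id[OF cQ(2)] by (metis zero_less_divide_1_iff zero_less_numeral)
  define X where "X = Q ^^ k"
  define l where "l = c ^ k"
  have X: "orthogonal_transformation X" "near (1/4) X" using orthogonal_funpow[OF cQ(2)] k by (auto simp: X_def)
  have linX: "linear X" using X(1) by (rule orthogonal_transformation_linear)
  have l: "l > 1" using cQ(1) k(1) by (simp add: l_def one_less_power)
  have psi: "\<exists>\<delta>\<in>\<Gamma>. lin \<delta> = X \<circ> lin \<gamma> \<circ> inv X \<and> \<delta> 0 = l *\<^sub>R X (\<gamma> 0)" if "\<gamma> \<in> \<Gamma>" for \<gamma>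
    using conformal_conjugate[OF grp cQ inv that, of k] by (simp add: X_def l_def)
  let ?T = "transl_vectors \<Gamma>" let ?V = "span ?T"
  \<comment> \<open>\<open>f (\<gamma> 0)\<close> is the difference of the translation parts of the
    conjugate and of \<gamma>. Expansion enters through \<open>l > 1\<close>, which makes
    \<open>f\<close> injective.\<close>
  define f where "f = (\<lambda>x. l *\<^sub>R X x - x)"
  have linf: "linear f" unfolding f_def using linX by (intro linear_compose_sub linear_compose_scale_right linear_ident)
  have injf: "inj f"
    unfolding linear_injective_0[OF linf]
  proof (intro allI impI)
    fix x assume "f x = 0"
    then have "norm (l *\<^sub>R X x) = norm x" by (simp add: f_def)
    then have "l * norm x = norm x" using l X(1) by (simp add: orthogonal_transformation_norm)
    then show "x = 0" using l by simp
  qed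
  have XT: "l *\<^sub>R X t \<in> ?T" if "t \<in> ?T" for t
  proof -
    obtain \<delta> where d: "\<delta> \<in> \<Gamma>" "lin \<delta> = X \<circ> lin (\<lambda>x. x + t) \<circ> inv X" "\<delta> 0 = l *\<^sub>R X t"
      using psi[of "\<lambda>x. x + t"] \<open>t \<in> ?T\<close> unfolding transl_vectors_def by auto
    have "\<delta> x = x + l *\<^sub>R X t" for x
      using lin_apply[of \<delta> x] d(2,3) by (simp add: lin_def[of "\<lambda>x. x + t"] orthogonal_inv_cancel X(1))
    then have "\<delta> = (\<lambda>x. x + l *\<^sub>R X t)" by auto
    then show ?thesis using d(1) by (simp add: transl_vectors_def)
  qed
  \<comment> \<open>On translation vectors \<open>f\<close> is a difference of two translation
    vectors. Injectivity and equality of dimensions then make \<open>f\<close> map the span onto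
    itself.\<close>
  have "f ` ?V \<subseteq> ?V"
  proof -
    have "f t \<in> ?V" if "t \<in> ?T" for t unfolding f_def using XT that by (intro span_diff span_base)
    then have "f ` ?T \<subseteq> ?V" by blast
    then show ?thesis using linear_span_image[OF linf, of ?T] by (metis span_minimal subspace_span)
  qed
  moreover have "dim (f ` ?V) = dim ?V" using linf injf by (intro dim_image_eq) (auto simp: inj_on_def)
  ultimately have fV: "f ` ?V = ?V"
    using linear_subspace_image[OF linf subspace_span] by (intro subspace_dim_equal) auto
  have inV: "\<gamma> 0 \<in> ?V" if g: "\<gamma> \<in> \<Gamma>" "near (1/8) (lin \<gamma>)" for \<gamma>
  proof -
    define B where "B = lin \<gamma>"
    have iso: "isometry_E \<gamma>" using G g by blast
    have B: "orthogonal_transformation B" "near (1/8) B" using orthogonal_lin[OF iso] g by (auto simp: B_def)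
    obtain \<delta> where d: "\<delta> \<in> \<Gamma>" "lin \<delta> = X \<circ> B \<circ> inv X" "\<delta> 0 = l *\<^sub>R X (\<gamma> 0)"
      using psi[OF g(1)] by (auto simp: B_def)
    have isod: "isometry_E \<delta>" using G d by blast
    \<comment> \<open>\<open>X\<close> need not be the linear part of an element of \<Gamma>, but
      \<open>commut B X\<close> is: it is the linear part of this \<sigma>. The iteration in the
      group therefore starts one commutator later, whence \<open>Suc j\<close> below.\<close>
    define \<sigma> where "\<sigma> = \<gamma> \<circ> inv \<delta>"
    have s: "\<sigma> \<in> \<Gamma>" using G g d by (auto simp: \<sigma>_def)
    have "inv (X \<circ> B \<circ> inv X) = X \<circ> inv B \<circ> inv X"
      by (rule inv_equality) (simp_all add: orthogonal_inv_cancel X B)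
    then have ls: "lin \<sigma> = commut B X"
      unfolding \<sigma>_def lin_compose[OF iso] lin_inv[OF isod] d(2) commut_def by (simp add: B_def o_assoc)
    have "near (2 * (1/8) * (1/4)) (lin \<sigma>)" unfolding ls using near_commut[OF B(1) X(1) B(2) X(2)] by simp
    then have "near 1 (lin \<sigma>)" unfolding near_def
    proof (intro allI, goal_cases)
      case (1 v)
      then have "norm (lin \<sigma> v - v) \<le> 2 * (1/8) * (1/4) * norm v" by blast
      then show ?case using norm_ge_zero[of v] by linarith
    qed
    then obtain i where i: "(commut \<gamma> ^^ i) \<sigma> = id" using iterated_commut_eq_id[OF disc g(1) s g(2)] by blast
    have "(commut \<gamma> ^^ j) \<sigma> \<in> \<Gamma> \<and> lin ((commut \<gamma> ^^ j) \<sigma>) = (commut B ^^ Suc j) X" for j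
    proof (induction j)
      case (Suc j) then show ?case using lin_commut[OF grp g(1)] by (simp add: B_def)
    qed (use s ls in simp)
    then have "(commut B ^^ Suc i) X = lin id" using i by metis
    then have "(commut B ^^ Suc i) X = id" by (simp add: lin_def fun_eq_iff)
    then have "commut B X = id" using commut_eq_id_if_iterated B X by blast
    then have BX: "B (X x) = X (B x)" for x
      using orthogonal_inv_cancel[OF B(1)] orthogonal_inv_cancel[OF X(1)]
      unfolding commut_def fun_eq_iff by (metis comp_apply id_apply)
    \<comment> \<open>As \<open>B\<close> and \<open>X\<close> commute, \<delta> has the same linear
      part as \<gamma>, so their quotient is a translation.\<close>
    have "(\<delta> \<circ> inv \<gamma>) x = x + f (\<gamma> 0)" for x
    proof -
      define y where "y = inv \<gamma> x"
      have x: "x = B y + \<gamma> 0" using lin_apply[of \<gamma> y] isometry_E_inv_cancel[OF iso] by (simp add: y_def B_def)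
      have "\<delta> y = B y + l *\<^sub>R X (\<gamma> 0)"
        using lin_apply[of \<delta> y] d(2,3) BX[of "inv X y"] by (simp add: orthogonal_inv_cancel X)
      also have "\<dots> = (B y + \<gamma> 0) + f (\<gamma> 0)" by (simp add: f_def)
      finally show ?thesis unfolding x[symmetric] by (simp add: y_def)
    qed
    then have "\<delta> \<circ> inv \<gamma> = (\<lambda>x. x + f (\<gamma> 0))" by auto
    then have "f (\<gamma> 0) \<in> ?T" using G(3)[OF d(1) G(4)[OF g(1)]] by (simp add: transl_vectors_def)
    then have "f (\<gamma> 0) \<in> f ` ?V" using fV span_base by blast
    then show ?thesis using injf by (simp add: inj_image_mem_iff)
  qed
  obtain R where R: "\<And>x. x \<in> ?V \<Longrightarrow> \<exists>t\<in>?T. norm (x - t) \<le> R"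
    using additive_subgroup_cobounded_in_span[of ?T] transl_vectors_subgroup[OF grp] by blast
  \<comment> \<open>Composing with a translation of \<Gamma> keeps the linear part and brings the
    translation part into a fixed ball, where local finiteness applies.\<close>
  have "ort ` {\<gamma>\<in>\<Gamma>. near (1/8) (lin \<gamma>)} \<subseteq> ort ` {\<gamma>\<in>\<Gamma>. norm (\<gamma> 0) \<le> R}"
  proof
    fix p assume "p \<in> ort ` {\<gamma>\<in>\<Gamma>. near (1/8) (lin \<gamma>)}"
    then obtain \<gamma> where g: "\<gamma> \<in> \<Gamma>" "near (1/8) (lin \<gamma>)" "p = ort \<gamma>" by blast
    obtain t where t: "t \<in> ?T" "norm (\<gamma> 0 - t) \<le> R" using R[OF inV[OF g(1,2)]] by blast
    have "(\<lambda>x. x + - t) \<in> \<Gamma>" using transl_vectors_subgroup(3)[OF grp t(1)] by (simp add: transl_vectors_def)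
    then have d: "(\<lambda>x. x + - t) \<circ> \<gamma> \<in> \<Gamma>" using G(3) g(1) by blast
    moreover have "ort ((\<lambda>x. x + - t) \<circ> \<gamma>) = ort \<gamma>" by (simp add: ort_def)
    moreover have "norm (((\<lambda>x. x + - t) \<circ> \<gamma>) 0) \<le> R" using t(2) by simp
    ultimately show "p \<in> ort ` {\<gamma>\<in>\<Gamma>. norm (\<gamma> 0) \<le> R}" using g(3) by (metis (mono_tags, lifting) image_eqI mem_Collect_eq)
  qed
  then have "finite (ort ` {\<gamma>\<in>\<Gamma>. near (1/8) (lin \<gamma>)})"
    using discrete_locally_finite[OF disc] finite_subset by blast
  then show ?thesis using finite_ort_if_finite_near[OF grp, of "1/8"] by simp
qed

theorem theorem1p5:
  fixes \<Gamma> :: "('n::finite) isom set" and A :: "'n isom"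
  assumes "discrete_isom_group \<Gamma>"
    and "expanding_conformal A"
    and "\<forall>\<gamma>\<in>\<Gamma>. A \<circ> \<gamma> \<circ> inv A \<in> \<Gamma>"
  shows "dim_group (transl_subgroup \<Gamma>) = dim_group \<Gamma>"
proof -
  have grp: "isom_group \<Gamma>" using assms(1) unfolding discrete_isom_group_def by blast
  have sub: "subgroup_of (transl_subgroup \<Gamma>) \<Gamma>" by (rule subgroup_transl_subgroup[OF grp])
  have sgrp: "isom_group (transl_subgroup \<Gamma>)" by (rule subgroup_of_isom_group[OF grp sub])
  have self: "subgroup_of (transl_subgroup \<Gamma>) (transl_subgroup \<Gamma>)"
    using sub unfolding subgroup_of_def by blast
  have "fi_cocompact_translation_pair \<Gamma> (transl_subgroup \<Gamma>) (span (transl_vectors \<Gamma>))"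
    unfolding fi_cocompact_translation_pair_def
    using cocompact_translation_pair_span[OF grp sub]
      finite_index_transl_subgroup[OF grp finite_ort_if_expanding[OF assms]] by blast
  moreover have "fi_cocompact_translation_pair (transl_subgroup \<Gamma>) (transl_subgroup \<Gamma>) (span (transl_vectors \<Gamma>))"
    unfolding fi_cocompact_translation_pair_def
    using cocompact_translation_pair_span[OF grp self] finite_index_self[OF sgrp] by blast
  ultimately show ?thesis using dim_group_eq grp sgrp by metis
qed

end
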